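(* Let $\hat\rho\ge0$ and $U,L\in\mathbb{R}^{n_x}$ be constants such that for any $x\in X_{LF}$, any $\rho\ge\hat\rho$ and any $\lambda\in\mathbb{R}^{n_x}$ satisfying, for all $i$, $\lambda_i\ge U_i$ if $x_i=1$ and $\lambda_i\le L_i$ if $x_i=0$, one has $\phi(x)=L_a(x,\lambda,\rho)$. Put $\hat\lambda(x):=U\odot(\mathbf 1-x)+L\odot x$. (a) For any $z\in[0,1]^{n_x}$, the inequality $$d_\ell^\top y\ge\psi(z)-(\hat\lambda(\mathbf 1-x))^\top(x-z)-\hat\rho\,(\mathbf 1^\top x+\mathbf 1^\top z-2x^\top z)$$ is valid for any $(x,y)\in X\times Y$ satisfying $d_\ell^\top y\ge\phi(x)$. (b) If $z\in\{0,1\}^{n_x}$, this inequality is valid and tight for $d_\ell^\top y\ge\phi(x)$, and it can be rewritten as $$d_\ell^\top y\ge\phi(z)-(\hat\lambda(z))^\top(x-z)-\hat\rho\,(\mathbf 1^\top x+\mathbf 1^\top z-2x^\top z).$$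
   Context: $X=\{0,1\}^{n_x}$, $Y\subseteq\mathbb{R}^{n_y}$, $d_\ell\in\mathbb{R}^{n_y}$, $A_\ell\in\mathbb{R}^{m_\ell\times n_x}$, $B_\ell\in\mathbb{R}^{m_\ell\times n_y}$, $h_\ell\in\mathbb{R}^{m_\ell}$; $\mathbf 1$ is the all-ones vector and $\odot$ the entrywise (Hadamard) product. For $x\in X$, $\phi(x)=\max\{d_\ell^\top y' : y'\in Y,\ B_\ell y'\le h_\ell-A_\ell x\}$, equal to $-\infty$ when infeasible. $X_{LF}=\{x\in\{0,1\}^{n_x}:\exists y'\in Y,\ B_\ell y'\le h_\ell-A_\ell x\}$. $\psi$ on $[0,1]^{n_x}$ is an extension of $\phi$, i.e. $\psi(z)=\phi(z)$ whenever $z\in\{0,1\}^{n_x}$, such that, with the other entries fixed, $\psi(z)$ is linear in each individual $z_i$; for example $\psi(z)=\sum_{x\in\{0,1\}^{n_x}}\phi(x)\prod_{i:x_i=1}z_i\prod_{i:x_i=0}(1-z_i)$. For $x\in\{0,1\}^{n_x}$, $\lambda\in\mathbb{R}^{n_x}$, $\rho\ge0$, $L_a(x,\lambda,\rho)=\max_{z\in[0,1]^{n_x}}\psi(z)-\lambda^\top(x-z)-\rho(\mathbf 1^\top x+\mathbf 1^\top z-2x^\top z)$. Terminology: for inequalities $f(x)\le0$ and $g(x)\le0$ in $x\in X$, $f(x)\le0$ is valid for $g(x)\le0$ if $f(x)\le g(x)$ for all $x\in X$; it is valid and tight if moreover $g(\hat x)=f(\hat x)$ for some $\hat x\in X$ (tight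 at $\hat x$). Thus an inequality $d_\ell^\top y\ge r(x)$ is valid for $d_\ell^\top y\ge\phi(x)$ if $r(x)\le\phi(x)$ for all $x\in X$, and tight at $\hat x$ if $r(\hat x)=\phi(\hat x)$.
   Formalization: Validity in (a) and (b) is asserted only for x in X_LF, not for all x in X: where the lower level is infeasible, φ(x) = −∞ and the inequality with a finite right-hand side can fail; tightness and the rewriting are over all of X. *)

theory Defs
  imports "HOL-Analysis.Analysis"
begin

text \<open>Vectors of dimension n are elements of \<^typ>\<open>real ^ 'n\<close>, where \<^term>\<open>(*)\<close>, \<^term>\<open>(\<le>)\<close> and
  the constant 1 are entrywise (Hadamard product, componentwise order, all-ones vector), so that
  \<open>{0..1}\<close> is the unit cube.\<close>

definition X_bin :: "(real ^ 'n) set" where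
  "X_bin = {x. \<forall>i. x $ i = 0 \<or> x $ i = 1}"

definition lower_feasible ::
  "(real ^ 'k) set \<Rightarrow> real ^ 'n ^ 'm \<Rightarrow> real ^ 'k ^ 'm \<Rightarrow> real ^ 'm \<Rightarrow> real ^ 'n \<Rightarrow> (real ^ 'k) set" where
  "lower_feasible Y A B h x = {y \<in> Y. B *v y \<le> h - A *v x}"

definition X_LF ::
  "(real ^ 'k) set \<Rightarrow> real ^ 'n ^ 'm \<Rightarrow> real ^ 'k ^ 'm \<Rightarrow> real ^ 'm \<Rightarrow> (real ^ 'n) set" where
  "X_LF Y A B h = {x \<in> X_bin. lower_feasible Y A B h x \<noteq> {}}"

text \<open>The supremum in the extended reals is the maximum whenever the latter is attained
  (\<open>phi_eq_max\<close>), and is minus infinity for an infeasible lower level (\<open>phi_infeasible\<close>).\<close>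

definition phi ::
  "(real ^ 'k) set \<Rightarrow> real ^ 'k \<Rightarrow> real ^ 'n ^ 'm \<Rightarrow> real ^ 'k ^ 'm \<Rightarrow> real ^ 'm \<Rightarrow> real ^ 'n \<Rightarrow> ereal" where
  "phi Y d A B h x = (SUP y \<in> lower_feasible Y A B h x. ereal (d \<bullet> y))"

lemma phi_infeasible: "lower_feasible Y A B h x = {} \<Longrightarrow> phi Y d A B h x = - \<infinity>"
  by (simp add: phi_def bot_ereal_def)

lemma phi_eq_max:
  assumes "y \<in> lower_feasible Y A B h x"
    and "\<And>y'. y' \<in> lower_feasible Y A B h x \<Longrightarrow> d \<bullet> y' \<le> d \<bullet> y"
  shows "phi Y d A B h x = ereal (d \<bullet> y)"
  unfolding phi_def using assms by (intro antisym SUP_least SUP_upper) auto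

definition vec_upd :: "real ^ 'n \<Rightarrow> 'n \<Rightarrow> real \<Rightarrow> real ^ 'n" where
  "vec_upd z i t = (\<chi> j. if j = i then t else z $ j)"

text \<open>Linearity (in the affine sense) in each single entry over the unit cube. It is stated as
  interpolation between the two endpoints, so that it also makes sense for functions with the
  value minus infinity, with the convention \<open>0 * (-\<infinity>) = 0\<close> of \<^typ>\<open>ereal\<close>.\<close>

definition linear_in_each_entry :: "(real ^ 'n \<Rightarrow> ereal) \<Rightarrow> bool" where
  "linear_in_each_entry psi \<longleftrightarrow>
     (\<forall>z \<in> {0..1}. \<forall>i. \<forall>t \<in> {0..1}.
        psi (vec_upd z i t) = ereal (1 - t) * psi (vec_upd z i 0) + ereal t * psi (vec_upd z i 1))"

text \<open>The value at \<open>z\<close> is passed as \<open>v\<close>: this is both the objective that \<open>L_a\<close> maximises over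
  \<open>z\<close> and, as a function of \<open>x\<close> with a multiplier that may depend on \<open>x\<close>, the right-hand side of
  a cut.\<close>

definition penalised ::
  "ereal \<Rightarrow> real ^ 'n \<Rightarrow> real \<Rightarrow> real ^ 'n \<Rightarrow> real ^ 'n \<Rightarrow> ereal" where
  "penalised v lam rho x z =
     v - ereal (lam \<bullet> (x - z)) - ereal (rho * (1 \<bullet> x + 1 \<bullet> z - 2 * (x \<bullet> z)))"

text \<open>If the values of \<open>psi\<close> are below plus infinity and \<open>psi\<close> is linear in each entry, the supremum
  is attained: \<open>psi\<close> is continuous on the closed union of those faces of the cube all of whose
  vertices have a finite value, and it is minus infinity elsewhere.\<close>

definition L_a :: "(real ^ 'n \<Rightarrow> ereal) \<Rightarrow> real ^ 'n \<Rightarrow> real ^ 'n \<Rightarrow> real \<Rightarrow> ereal" where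
  "L_a psi x lam rho = (SUP z \<in> {0..1}. penalised (psi z) lam rho x z)"

definition lam_hat :: "real ^ 'n \<Rightarrow> real ^ 'n \<Rightarrow> real ^ 'n \<Rightarrow> real ^ 'n" where
  "lam_hat U L x = U * (1 - x) + L * x"

text \<open>For inequalities \<open>d \<bullet> y \<ge> r x\<close> and \<open>d \<bullet> y \<ge> p x\<close>: the first is valid for the second on \<open>S\<close>,
  and tight at some point of \<open>S\<close>. The set is a parameter because a cut with a finite right-hand side
  can only be valid for \<open>phi\<close> where \<open>phi\<close> is not minus infinity, that is, on \<^const>\<open>X_LF\<close>.\<close>

definition valid_on :: "'a set \<Rightarrow> ('a \<Rightarrow> ereal) \<Rightarrow> ('a \<Rightarrow> ereal) \<Rightarrow> bool" where
  "valid_on S r p \<longleftrightarrow> (\<forall>x \<in> S. r x \<le> p x)"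

definition tight_on :: "'a set \<Rightarrow> ('a \<Rightarrow> ereal) \<Rightarrow> ('a \<Rightarrow> ereal) \<Rightarrow> bool" where
  "tight_on S r p \<longleftrightarrow> (\<exists>x \<in> S. r x = p x)"

end

theory Submission
  imports Defs
begin

text \<open>By exactness, \<open>phi\<close> at a feasible \<open>x\<close> is the supremum over the
  cube that defines \<open>L_a\<close>, so each single \<open>z\<close> gives a lower bound on it.
  The multiplier may be chosen afresh for each \<open>x\<close>, and
  \<open>lam_hat U L (1 - x)\<close> is always admissible; this is the cut. For binary
  \<open>z\<close>, taking \<open>x = z\<close> makes both correction terms vanish
  (\<open>penalised_diag\<close>), whence tightness. The rewriting holds because an entry with
  \<open>x $ i\<close> different from \<open>z $ i\<close> has \<open>1 - x $ i = z $ i\<close>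
  (\<open>lam_hat_inner_diff\<close>).\<close>

lemma X_bin_subset_cube: "X_bin \<subseteq> {0..1}"
proof
  fix z :: "real ^ 'n"
  assume "z \<in> X_bin"
  then have "0 \<le> z $ i \<and> z $ i \<le> 1" for i
    unfolding X_bin_def by (metis (mono_tags, lifting) mem_Collect_eq order_refl zero_le_one)
  then show "z \<in> {0..1}"
    by (simp add: less_eq_vec_def)
qed

text \<open>Between binary vectors the bracket multiplied by \<open>rho\<close> is the Hamming
  distance, hence 0 on the diagonal; in the proof this is idempotence of 0 and 1. Only zeros are
  subtracted, so \<open>v\<close> may be infinite.\<close>

lemma penalised_diag:
  assumes "z \<in> X_bin"
  shows "penalised v lam rho z z = v"
proof -
  have "z $ i * z $ i = z $ i" for i
    using assms by (auto simp: X_bin_def dest: spec[of _ i])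
  then have "z \<bullet> z = 1 \<bullet> z"
    by (simp only: inner_vec_def inner_real_def one_index mult_1)
  then show ?thesis
    by (simp add: penalised_def)
qed

text \<open>The two multipliers differ only in entries where \<open>x\<close> and \<open>z\<close> agree.\<close>

lemma lam_hat_inner_diff:
  assumes "x \<in> X_bin" "z \<in> X_bin"
  shows "lam_hat U L (1 - x) \<bullet> (x - z) = lam_hat U L z \<bullet> (x - z)"
proof -
  have "lam_hat U L (1 - x) $ i * (x - z) $ i = lam_hat U L z $ i * (x - z) $ i" for i
  proof -
    have "x $ i = 0 \<or> x $ i = 1" "z $ i = 0 \<or> z $ i = 1"
      using assms by (auto simp: X_bin_def)
    then show ?thesis
      by (auto simp: lam_hat_def)
  qed
  then show ?thesis
    by (simp only: inner_vec_def inner_real_def)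
qed

theorem proposition3:
  fixes Y :: "(real ^ 'k) set" and d :: "real ^ 'k"
    and A :: "real ^ 'n ^ 'm" and B :: "real ^ 'k ^ 'm" and h :: "real ^ 'm"
    and psi :: "real ^ 'n \<Rightarrow> ereal"
    and rho_hat :: real and U L :: "real ^ 'n"
  assumes psi_extends: "\<And>z. z \<in> X_bin \<Longrightarrow> psi z = phi Y d A B h z"
    and psi_linear: "linear_in_each_entry psi"
    and rho_hat_nonneg: "0 \<le> rho_hat"
    and exact: "\<And>x rho lam.
        \<lbrakk>x \<in> X_LF Y A B h; rho_hat \<le> rho;
         \<forall>i. (x $ i = 1 \<longrightarrow> U $ i \<le> lam $ i) \<and> (x $ i = 0 \<longrightarrow> lam $ i \<le> L $ i)\<rbrakk>
        \<Longrightarrow> phi Y d A B h x = L_a psi x lam rho"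
  shows "(\<forall>z \<in> {0..1}.
            valid_on (X_LF Y A B h)
              (\<lambda>x. penalised (psi z) (lam_hat U L (1 - x)) rho_hat x z) (phi Y d A B h) \<and>
            (\<forall>x \<in> X_LF Y A B h. \<forall>y \<in> Y. phi Y d A B h x \<le> ereal (d \<bullet> y) \<longrightarrow>
               penalised (psi z) (lam_hat U L (1 - x)) rho_hat x z \<le> ereal (d \<bullet> y))) \<and>
         (\<forall>z \<in> X_bin.
            valid_on (X_LF Y A B h)
              (\<lambda>x. penalised (psi z) (lam_hat U L (1 - x)) rho_hat x z) (phi Y d A B h) \<and>
            tight_on X_bin
              (\<lambda>x. penalised (psi z) (lam_hat U L (1 - x)) rho_hat x z) (phi Y d A B h) \<and>
            (\<forall>x \<in> X_bin.
               penalised (psi z) (lam_hat U L (1 - x)) rho_hat x z =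
               penalised (phi Y d A B h z) (lam_hat U L z) rho_hat x z))"
proof -
  have cut: "penalised (psi z) (lam_hat U L (1 - x)) rho_hat x z \<le> phi Y d A B h x"
    if "x \<in> X_LF Y A B h" "z \<in> {0..1}" for x z
  proof -
    \<comment> \<open>The multiplier is \<open>U * x + L * (1 - x)\<close>, so it meets the required
      bounds with equality.\<close>
    have "\<forall>i. (x $ i = 1 \<longrightarrow> U $ i \<le> lam_hat U L (1 - x) $ i) \<and>
              (x $ i = 0 \<longrightarrow> lam_hat U L (1 - x) $ i \<le> L $ i)"
      by (simp add: lam_hat_def)
    then have "phi Y d A B h x = L_a psi x (lam_hat U L (1 - x)) rho_hat"
      using that by (intro exact) simp_all
    moreover have "penalised (psi z) (lam_hat U L (1 - x)) rho_hat x z \<le>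
        L_a psi x (lam_hat U L (1 - x)) rho_hat"
      unfolding L_a_def by (rule SUP_upper) (rule that(2))
    ultimately show ?thesis
      by (simp only:)
  qed
  \<comment> \<open>The witness for tightness is \<open>z\<close> itself; if the lower level is
    infeasible there, both sides are minus infinity.\<close>
  have tight: "penalised (psi z) (lam_hat U L (1 - z)) rho_hat z z = phi Y d A B h z"
    if "z \<in> X_bin" for z
    using that by (simp add: penalised_diag psi_extends)
  have rewrite: "penalised (psi z) (lam_hat U L (1 - x)) rho_hat x z =
      penalised (phi Y d A B h z) (lam_hat U L z) rho_hat x z"
    if "x \<in> X_bin" "z \<in> X_bin" for x z
    using lam_hat_inner_diff[OF that] that by (simp add: penalised_def psi_extends)
  show ?thesis
    unfolding valid_on_def tight_on_def
    \<comment> \<open>The form with \<open>y\<close> follows from \<open>cut\<close> by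
      transitivity; the cube inclusion lets \<open>cut\<close> apply to binary
      \<open>z\<close>.\<close>
    using cut tight rewrite X_bin_subset_cube by (blast intro: order_trans)
qed

end
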